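(* Let $\theta:(0,\infty)\to(0,\infty)$, $u_0:(0,\infty)\to\mathbb{R}$ and $f:[0,\infty)\times\mathbb{R}\times(0,\infty)\to\overline{\mathbb{R}}$ be such that for each $\lambda>0$, $\lim_{t\to\theta(\lambda),\,t<\theta(\lambda)}f(t,x,\lambda)=\pm\infty$ for almost all $x\in\mathbb{R}$. Assume the following. (i) For each $\lambda>0$ and $0<\varepsilon<\theta(\lambda)$ there is a constant $L(\lambda,\varepsilon)$ such that $|f(t,x,\lambda)-f(t,\overline{x},\lambda)|\le L(\lambda,\varepsilon)|x-\overline{x}|$ for all $x,\overline{x}\in\mathbb{R}$ and all $t\in[0,\theta(\lambda)-\varepsilon]$. (ii) The maps $\lambda\mapsto\theta(\lambda)$, $\lambda\mapsto u_0(\lambda)$ and, for each $\varepsilon>0$, $\lambda\mapsto L(\lambda,\varepsilon)$ are continuous, and $(t,x,\lambda)\mapsto f(t,x,\lambda)$ is continuous for $t\in[0,\theta(\lambda))$, $x\in\mathbb{R}$, $\lambda\in(0,\infty)$. (iii) There is a constant $a>1$ such that for all $\lambda>0$, $|f(t,x,\lambda)|\le\frac{|x|}{a(\theta(\lambda)-t)}+C_\lambda$ for all $t\in[0,\theta(\lambda))$ and all $x\in\mathbb{R}$, where $C_\lambda\ge 0$ and $\lambda\mapsto C_\lambda$ is continuous. For $\lambda>0$ let $u_\lambda\in C[0,\theta(\lambda))$ be the unique solution of $u'(t)=f(t,u(t),\lambda)$, $t\in[0,\theta(\lambda))$, $u(0)=u_0(\lambda)$, and let $\varphi(\lambda)=\int_0^{\theta(\lambda)}u_\lambda(s)\,ds$.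 Let $p\in\mathbb{R}$ and let $\underline{\lambda},\overline{\lambda}>0$ satisfy $\varphi(\underline{\lambda})<p$ and $\varphi(\overline{\lambda})>p$. Then the bisection algorithm started from $\underline{\lambda},\overline{\lambda}$ (described in the context) converges to a solution of the control problem; that is, either it stops after finitely many steps at some $\lambda^*>0$ with $\varphi(\lambda^* )=p$, or it generates infinite sequences $(\underline{\lambda}_k)$ and $(\overline{\lambda}_k)$ which both converge to the same limit $\lambda^*>0$, and $\varphi(\lambda^* )=p$.
   Context: $\overline{\mathbb{R}}=\mathbb{R}\cup\{\pm\infty\}$; $f$ is real-valued for $t\in[0,\theta(\lambda))$. The map $\lambda\mapsto L(\lambda,\varepsilon)$ is considered for those $\lambda$ with $\theta(\lambda)>\varepsilon$. Under (i) and (ii) the initial value problem has, for each $\lambda>0$, a unique solution $u_\lambda\in C[0,\theta(\lambda))$, and under (i)-(iii) the integral defining $\varphi(\lambda)$ converges. Integrals over $[0,\theta(\lambda))$ are improper: $\int_0^{\theta(\lambda)}u(s)\,ds=\lim_{t\to\theta(\lambda),\,t<\theta(\lambda)}\int_0^t u(s)\,ds$. No order between $\underline{\lambda}$ and $\overline{\lambda}$ is assumed. Control problem: find $\lambda^*>0$ such that $\varphi(\lambda^* )=p$. Bisection algorithm: set $\underline{\lambda}_0:=\underline{\lambda}$, $\overline{\lambda}_0:=\overline{\lambda}$. At step $k\ge1$ compute $\lambda:=\frac{\underline{\lambda}_{k-1}+\overline{\lambda}_{k-1}}{2}$. If $\varphi(\lambda)=p$, then set $\lambda^*=\lambda$ and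 stop. If $\varphi(\lambda)<p$, set $\underline{\lambda}_k:=\lambda$, $\overline{\lambda}_k:=\overline{\lambda}_{k-1}$ and go to step $k+1$. If $\varphi(\lambda)>p$, set $\underline{\lambda}_k:=\underline{\lambda}_{k-1}$, $\overline{\lambda}_k:=\lambda$ and go to step $k+1$. *)

theory Defs
  imports "HOL-Analysis.Analysis"
begin

text \<open>
  The right-hand side \<open>f t x lam\<close> is extended-real-valued, but it is finite for
  \<open>0 \<le> t < \<theta> lam\<close>, the only range on which \<open>real_of_ereal\<close> is applied to it.
  At \<open>t = 0\<close> the derivative is one-sided.
\<close>

definition ivp_solution ::
  "(real \<Rightarrow> real \<Rightarrow> real \<Rightarrow> ereal) \<Rightarrow> (real \<Rightarrow> real) \<Rightarrow> (real \<Rightarrow> real) \<Rightarrow> real \<Rightarrow> (real \<Rightarrow> real) \<Rightarrow> bool"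
where
  "ivp_solution f \<theta> u0 lam u \<longleftrightarrow>
     continuous_on {0..<\<theta> lam} u \<and>
     u 0 = u0 lam \<and>
     (\<forall>t\<in>{0..<\<theta> lam}.
        (u has_real_derivative real_of_ereal (f t (u t) lam)) (at t within {0..<\<theta> lam}))"

text \<open>
  A solution is a function on \<open>[0, \<theta> lam)\<close> only. Uniqueness of a total HOL function
  requires fixing its values elsewhere, which is the sole purpose of \<open>extensional\<close>.
\<close>

definition ivp_sol ::
  "(real \<Rightarrow> real \<Rightarrow> real \<Rightarrow> ereal) \<Rightarrow> (real \<Rightarrow> real) \<Rightarrow> (real \<Rightarrow> real) \<Rightarrow> real \<Rightarrow> real \<Rightarrow> real"
where
  "ivp_sol f \<theta> u0 lam = (THE u. u \<in> extensional {0..<\<theta> lam} \<and> ivp_solution f \<theta> u0 lam u)"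

definition control_map ::
  "(real \<Rightarrow> real \<Rightarrow> real \<Rightarrow> ereal) \<Rightarrow> (real \<Rightarrow> real) \<Rightarrow> (real \<Rightarrow> real) \<Rightarrow> real \<Rightarrow> real"
where
  "control_map f \<theta> u0 lam = Lim (at_left (\<theta> lam)) (\<lambda>t. integral {0..t} (ivp_sol f \<theta> u0 lam))"

text \<open>
  \<open>Running l h\<close> carries the current pair of a lower and an upper parameter (in the sense
  of the values of \<open>\<phi>\<close>; no order between \<open>l\<close> and \<open>h\<close> is implied), and \<open>Stopped m\<close>
  records termination with output \<open>m\<close>.
\<close>

datatype bisection_state = Running real real | Stopped real

fun bisection_step ::
  "(real \<Rightarrow> real) \<Rightarrow> real \<Rightarrow> bisection_state \<Rightarrow> bisection_state"
where
  "bisection_step \<phi> p (Running l h) =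
     (let m = (l + h) / 2 in
      if \<phi> m = p then Stopped m
      else if \<phi> m < p then Running m h
      else Running l m)"
| "bisection_step \<phi> p (Stopped m) = Stopped m"

definition bisection ::
  "(real \<Rightarrow> real) \<Rightarrow> real \<Rightarrow> real \<Rightarrow> real \<Rightarrow> nat \<Rightarrow> bisection_state"
where
  "bisection \<phi> p l h k = (bisection_step \<phi> p ^^ k) (Running l h)"

end

theory Submission
  imports Defs
begin

text \<open>
  The theorem holds because \<open>\<phi>\<close> is continuous on \<open>(0, \<infinity>)\<close>. Unless it meets a solution after
  finitely many steps, bisection keeps \<open>\<phi> < p\<close> at one parameter and \<open>\<phi> > p\<close> at the other while
  halving their distance, so that both converge to a point where \<open>\<phi> = p\<close> (\<open>bisection_converges\<close>).

  Continuity of \<open>\<phi>\<close> (\<open>control_map_cont\<close>) is obtained by splitting the improper integral at a time \<open>T\<close>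
  slightly before \<open>\<theta> lam0\<close>. On \<open>[0, T]\<close> the right-hand side is Lipschitz in \<open>x\<close>, with a constant
  that is locally bounded in the parameter, so the trajectories and their integrals depend
  continuously on the parameter by Gronwall's inequality (\<open>integral_sol_cont\<close>). After \<open>T\<close>, the
  growth condition \<open>\<bar>u'\<bar> \<le> \<bar>u\<bar> / (a * (\<theta> - t)) + C\<close> gives, again by Gronwall, a bound
  \<open>\<bar>u t\<bar> \<le> amplitude * (\<theta> - t) powr (- 1/a)\<close> (\<open>sol_bound\<close>). As \<open>a > 1\<close>, this is integrable, and
  the remaining integral is small uniformly for nearby parameters (\<open>control_map_tail\<close>).

  Existence of trajectories comes from Picard's theorem on compact time intervals
  (\<open>picard_lindelof_Icc\<close>), and the solutions are glued by uniqueness (\<open>ivp_solution_exists\<close>).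
\<close>

section \<open>A Gronwall inequality\<close>

text \<open>
  A Gronwall inequality for \<open>\<bar>y\<bar>\<close>. The kernel \<open>k\<close> is given through a primitive \<open>K\<close>, so that it may be
  constant (stability of trajectories) or explode as \<open>b\<close> approaches a final time (growth of
  trajectories). As \<open>\<bar>y\<bar>\<close> need not be differentiable, the proof works with the smooth
  majorant \<open>sqrt (y\<^sup>2 + \<eta>\<^sup>2)\<close> and lets \<open>\<eta>\<close> tend to \<open>0\<close>.
\<close>

lemma gronwall_abs:
  fixes y y' K k :: "real \<Rightarrow> real" and a b c :: real
  assumes "a \<le> b" "c \<ge> 0"
    and y_cont: "continuous_on {a..b} y"
    and y_deriv: "\<And>s. s \<in> {a<..<b} \<Longrightarrow> (y has_real_derivative y' s) (at s)"
    and K_cont: "continuous_on {a..b} K"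
    and K_deriv: "\<And>s. s \<in> {a<..<b} \<Longrightarrow> (K has_real_derivative k s) (at s)"
    and k_nonneg: "\<And>s. s \<in> {a<..<b} \<Longrightarrow> k s \<ge> 0"
    and y'_le: "\<And>s. s \<in> {a<..<b} \<Longrightarrow> \<bar>y' s\<bar> \<le> k s * \<bar>y s\<bar> + c"
  shows "\<bar>y b\<bar> \<le> exp (K b - K a) * (\<bar>y a\<bar> + c * (b - a))"
proof -
  have K_mono: "K a \<le> K s" if "s \<in> {a..b}" for s
    by (rule DERIV_nonneg_imp_increasing_open[where f = K])
       (use that K_deriv k_nonneg K_cont in \<open>auto intro: continuous_on_subset\<close>, force)
  have regularised: "\<bar>y b\<bar> \<le> exp (K b - K a) * (\<bar>y a\<bar> + \<eta> + c * (b - a))" if "\<eta> > 0" for \<eta>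
  proof -
    define r where "r s = sqrt ((y s)\<^sup>2 + \<eta>\<^sup>2)" for s
    define W where "W s = exp (K a - K s) * r s - c * (s - a)" for s
    have r_pos: "r s > 0" and y_le_r: "\<bar>y s\<bar> \<le> r s" and r_le: "r s \<le> \<bar>y s\<bar> + \<eta>" for s
      unfolding r_def using that
      by (auto intro: add_nonneg_pos real_le_rsqrt sqrt_le_D real_le_lsqrt
          simp: power2_sum real_sqrt_ge_abs1)
    \<comment> \<open>The monotonicity of \<open>K\<close> gives \<open>exp (K a - K s) \<le> 1\<close>, so the inhomogeneity contributes at most \<open>c\<close>.\<close>
    have "W b \<le> W a"
    proof (rule DERIV_nonpos_imp_decreasing_open[where f = W])
      show "a \<le> b" by fact
      show "continuous_on {a..b} W"
        unfolding W_def r_def by (intro continuous_intros y_cont K_cont)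
      fix s assume s: "a < s" "s < b"
      have r_deriv: "(r has_real_derivative y s * y' s / r s) (at s)"
        unfolding r_def
        by (rule derivative_eq_intros y_deriv refl | use s r_pos[of s] in \<open>force simp: r_def divide_simps\<close>)+
      define d where "d = exp (K a - K s) * (y s * y' s / r s - k s * r s) - c"
      have "(W has_real_derivative d) (at s)"
        unfolding W_def d_def
        by (rule derivative_eq_intros r_deriv K_deriv refl | use s in \<open>force simp: algebra_simps\<close>)+
      moreover have "d \<le> 0"
      proof -
        have "y s * y' s \<le> r s * (k s * r s + c)"
        proof -
          have "y s * y' s \<le> \<bar>y s\<bar> * \<bar>y' s\<bar>"
            by (metis abs_ge_self abs_mult)
          also have "\<dots> \<le> r s * (k s * r s + c)"
          proof (rule mult_mono)
            have "k s * \<bar>y s\<bar> \<le> k s * r s"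
              using y_le_r k_nonneg[of s] s by (intro mult_left_mono) auto
            then show "\<bar>y' s\<bar> \<le> k s * r s + c"
              using y'_le[of s] s by auto
          qed (use y_le_r r_pos[of s] in auto)
          finally show ?thesis .
        qed
        then have "y s * y' s / r s \<le> k s * r s + c"
          using r_pos[of s] by (simp add: pos_divide_le_eq mult.commute)
        then have "exp (K a - K s) * (y s * y' s / r s - k s * r s) \<le> exp (K a - K s) * c"
          by (intro mult_left_mono) auto
        also have "\<dots> \<le> c"
          using K_mono[of s] s \<open>c \<ge> 0\<close> by (simp add: mult_left_le_one_le)
        finally show ?thesis by (simp add: d_def)
      qed
      ultimately show "\<exists>d. (W has_real_derivative d) (at s) \<and> d \<le> 0" by blast
    qed
    then have "exp (K a - K b) * r b \<le> r a + c * (b - a)"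
      by (simp add: W_def)
    then have "exp (K b - K a) * (exp (K a - K b) * r b) \<le> exp (K b - K a) * (r a + c * (b - a))"
      by (intro mult_left_mono) auto
    then have "r b \<le> exp (K b - K a) * (r a + c * (b - a))"
      by (simp flip: mult.assoc exp_add)
    also have "\<dots> \<le> exp (K b - K a) * (\<bar>y a\<bar> + \<eta> + c * (b - a))"
      using r_le[of a] by (intro mult_left_mono) auto
    finally show ?thesis using y_le_r[of b] by linarith
  qed
  have "((\<lambda>\<eta>. exp (K b - K a) * (\<bar>y a\<bar> + \<eta> + c * (b - a))) \<longlongrightarrow>
        exp (K b - K a) * (\<bar>y a\<bar> + 0 + c * (b - a))) (at_right 0)"
    by (intro tendsto_intros)
  then have "\<bar>y b\<bar> \<le> exp (K b - K a) * (\<bar>y a\<bar> + 0 + c * (b - a))"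
    by (rule tendsto_lowerbound)
       (auto intro!: eventually_mono[OF eventually_at_right_less] regularised)
  then show ?thesis by simp
qed

section \<open>Existence of solutions on compact time intervals\<close>

lemma continuous_on_along_curve:
  fixes g :: "real \<Rightarrow> real \<Rightarrow> real"
  assumes "continuous_on (S \<times> UNIV) (\<lambda>(t, x). g t x)" "continuous_on S u"
  shows "continuous_on S (\<lambda>t. g t (u t))"
  by (rule continuous_on_compose2[OF assms(1), of S "\<lambda>t. (t, u t)", simplified])
     (auto intro!: continuous_intros assms(2))

text \<open>
  Existence for a right-hand side that is globally Lipschitz in \<open>x\<close>, on a compact time interval
  of any length. Writing \<open>u t = exp (K * t) * v t\<close> with \<open>K > 2 * L\<close> makes the Picard operator a
  contraction for the unknown \<open>v\<close> in the ordinary supremum norm, so one application of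
  Banach's fixed point theorem covers the whole interval.
\<close>

lemma picard_lindelof_Icc:
  fixes g :: "real \<Rightarrow> real \<Rightarrow> real" and a b L x0 :: real
  assumes "a \<le> b" "L \<ge> 0"
    and g_cont: "continuous_on ({a..b} \<times> UNIV) (\<lambda>(t, x). g t x)"
    and g_lip: "\<And>t x x'. t \<in> {a..b} \<Longrightarrow> \<bar>g t x - g t x'\<bar> \<le> L * \<bar>x - x'\<bar>"
  obtains u where "u a = x0"
    "\<And>t. t \<in> {a..b} \<Longrightarrow> (u has_real_derivative g t (u t)) (at t within {a..b})"
proof -
  define K where "K = 2 * L + 1"
  have K: "K > 0" "L / K \<le> 1/2" using \<open>L \<ge> 0\<close> by (auto simp: K_def field_simps)
  \<comment> \<open>Bounded continuous functions live on the whole line: evaluation is clamped to \<open>[a, b]\<close>.\<close>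
  define c where "c t = max a (min b t)" for t :: real
  have c_in: "c t \<in> {a..b}" for t using \<open>a \<le> b\<close> by (auto simp: c_def)
  have c_id: "c t = t" if "t \<in> {a..b}" for t using that by (auto simp: c_def)
  have c_cont: "continuous_on UNIV c" unfolding c_def by (intro continuous_intros)
  define G where "G v s = g s (exp (K * s) * v s)" for v :: "real \<Rightarrow> real" and s
  define P where "P v t = exp (- K * t) * (x0 + integral {a..t} (G v))" for v t
  have G_cont: "continuous_on {a..b} (G v)" if "continuous_on UNIV v" for v
    unfolding G_def
    by (rule continuous_on_along_curve[OF g_cont])
       (intro continuous_intros continuous_on_subset[OF that], auto)
  have G_int: "G v integrable_on {a..t}" if "continuous_on UNIV v" "t \<in> {a..b}" for v t
    by (rule integrable_continuous_real, rule continuous_on_subset[OF G_cont]) (use that in auto)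
  have P_bcontfun: "P v \<circ> c \<in> bcontfun" if "continuous_on UNIV v" for v
  proof -
    have P_cont: "continuous_on {a..b} (P v)"
      unfolding P_def
      by (intro continuous_intros indefinite_integral_continuous_1 G_int that) (use \<open>a \<le> b\<close> in auto)
    have "range (P v \<circ> c) \<subseteq> P v ` {a..b}" using c_in by auto
    moreover have "bounded (P v ` {a..b})"
      by (intro compact_imp_bounded compact_continuous_image P_cont) auto
    moreover have "continuous_on UNIV (P v \<circ> c)"
      by (intro continuous_on_compose c_cont continuous_on_subset[OF P_cont]) (use c_in in auto)
    ultimately show ?thesis by (auto simp: bcontfun_def intro: bounded_subset)
  qed
  \<comment> \<open>\<open>P\<close> is the Picard operator in the unknown \<open>v\<close>; \<open>\<Phi>\<close> is its clamped version.\<close>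
  define \<Phi> where "\<Phi> v = Bcontfun (P (apply_bcontfun v) \<circ> c)" for v
  have \<Phi>_apply: "apply_bcontfun (\<Phi> v) t = P (apply_bcontfun v) (c t)" for v t
    unfolding \<Phi>_def by (subst Bcontfun_inverse[OF P_bcontfun]) auto
  have contraction: "dist (\<Phi> v) (\<Phi> w) \<le> 1/2 * dist v w" for v w
  proof (rule dist_bound)
    fix t0
    define t where "t = c t0"
    have t: "t \<in> {a..b}" using c_in by (simp add: t_def)
    define d where "d = dist v w"
    have "\<bar>integral {a..t} (G v) - integral {a..t} (G w)\<bar> = \<bar>integral {a..t} (\<lambda>s. G v s - G w s)\<bar>"
      using G_int t by (subst integral_diff) auto
    also have "\<dots> \<le> integral {a..t} (\<lambda>s. L * d * exp (K * s))"
    proof (rule Henstock_Kurzweil_Integration.integral_norm_bound_integral[where f = "\<lambda>s. G v s - G w s", unfolded real_norm_def])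
      show "(\<lambda>s. G v s - G w s) integrable_on {a..t}" using G_int t by (intro integrable_diff) auto
      show "(\<lambda>s. L * d * exp (K * s)) integrable_on {a..t}"
        by (intro integrable_continuous_real continuous_intros)
      fix s assume s: "s \<in> {a..t}"
      have "\<bar>G v s - G w s\<bar> \<le> L * \<bar>exp (K * s) * v s - exp (K * s) * w s\<bar>"
        unfolding G_def using s t by (intro g_lip) auto
      also have "\<dots> = L * (exp (K * s) * dist (v s) (w s))"
        by (simp add: dist_real_def abs_mult flip: right_diff_distrib)
      also have "\<dots> \<le> L * (exp (K * s) * d)"
        unfolding d_def using \<open>L \<ge> 0\<close> by (intro mult_left_mono dist_bounded) auto
      finally show "\<bar>G v s - G w s\<bar> \<le> L * d * exp (K * s)" by (simp add: mult_ac)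
    qed
    also have "integral {a..t} (\<lambda>s. L * d * exp (K * s)) = L * d * exp (K * t) / K - L * d * exp (K * a) / K"
      by (intro integral_unique fundamental_theorem_of_calculus)
         (use t K in \<open>auto intro!: derivative_eq_intros simp flip: has_real_derivative_iff_has_vector_derivative\<close>)
    also have "\<dots> \<le> (L / K) * d * exp (K * t)"
      using K \<open>L \<ge> 0\<close> by (simp add: d_def)
    also have "\<dots> \<le> 1/2 * d * exp (K * t)"
      using K by (intro mult_right_mono) (auto simp: d_def)
    finally have *: "\<bar>integral {a..t} (G v) - integral {a..t} (G w)\<bar> \<le> 1/2 * d * exp (K * t)" .
    have "dist (P v t) (P w t) = exp (- K * t) * \<bar>integral {a..t} (G v) - integral {a..t} (G w)\<bar>"
      by (simp add: P_def dist_real_def abs_mult flip: right_diff_distrib)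
    also have "\<dots> \<le> exp (- K * t) * (1/2 * d * exp (K * t))"
      by (intro mult_left_mono *) auto
    also have "\<dots> = 1/2 * d" by (simp add: exp_minus)
    finally show "dist (apply_bcontfun (\<Phi> v) t0) (apply_bcontfun (\<Phi> w) t0) \<le> 1/2 * dist v w"
      by (simp add: \<Phi>_apply d_def t_def)
  qed
  then obtain v where v: "\<Phi> v = v"
    using banach_fix_type[of "1/2" \<Phi>] by auto
  define u where "u t = exp (K * t) * v t" for t
  have u_eq: "u t = x0 + integral {a..t} (\<lambda>s. g s (u s))" if "t \<in> {a..b}" for t
    using \<Phi>_apply[of v t] that
    by (simp add: v c_id u_def P_def G_def[abs_def] exp_minus)
  have gu_cont: "continuous_on {a..b} (\<lambda>s. g s (u s))"
    using G_cont[of v] by (simp add: G_def[abs_def] u_def)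
  show ?thesis
  proof
    show "u a = x0" using u_eq[of a] \<open>a \<le> b\<close> by simp
    fix t assume t: "t \<in> {a..b}"
    have "((\<lambda>t. x0 + integral {a..t} (\<lambda>s. g s (u s))) has_real_derivative g t (u t)) (at t within {a..b})"
      using integral_has_real_derivative[OF gu_cont t] by (auto intro!: derivative_eq_intros)
    then show "(u has_real_derivative g t (u t)) (at t within {a..b})"
      by (rule has_field_derivative_transform_within[OF _ zero_less_one t]) (use u_eq in auto)
  qed
qed

section \<open>The family of initial value problems\<close>

text \<open>
  The family of initial value problems \<open>u' = f t u lam\<close>, \<open>u 0 = u0 lam\<close> on \<open>[0, \<theta> lam)\<close>, indexed by
  \<open>lam > 0\<close>: a Lipschitz condition away from the final time, continuity of the data, and
  growth of \<open>f\<close> at most linear in \<open>x\<close> with a singular factor of strength \<open>1/a < 1\<close> at the final time.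
\<close>

locale control_problem =
  fixes \<theta> u0 C :: "real \<Rightarrow> real"
    and f :: "real \<Rightarrow> real \<Rightarrow> real \<Rightarrow> ereal"
    and L :: "real \<Rightarrow> real \<Rightarrow> real"
    and a :: real
  assumes theta_pos: "\<And>lam. lam > 0 \<Longrightarrow> \<theta> lam > 0"
    and f_finite: "\<And>lam t x. lam > 0 \<Longrightarrow> t \<in> {0..<\<theta> lam} \<Longrightarrow> \<bar>f t x lam\<bar> \<noteq> \<infinity>"
    and lipschitz: "\<And>lam \<epsilon> t x x'. lam > 0 \<Longrightarrow> 0 < \<epsilon> \<Longrightarrow> \<epsilon> < \<theta> lam \<Longrightarrow> t \<in> {0..\<theta> lam - \<epsilon>} \<Longrightarrow>
        \<bar>f t x lam - f t x' lam\<bar> \<le> ereal (L lam \<epsilon> * \<bar>x - x'\<bar>)"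
    and theta_cont: "continuous_on {0<..} \<theta>"
    and u0_cont: "continuous_on {0<..} u0"
    and L_cont: "\<And>\<epsilon>. \<epsilon> > 0 \<Longrightarrow> continuous_on {lam. lam > 0 \<and> \<theta> lam > \<epsilon>} (\<lambda>lam. L lam \<epsilon>)"
    and f_cont: "continuous_on {(t, x, lam). lam > 0 \<and> t \<in> {0..<\<theta> lam}} (\<lambda>(t, x, lam). f t x lam)"
    and a_gt_1: "a > 1"
    and growth: "\<And>lam t x. lam > 0 \<Longrightarrow> t \<in> {0..<\<theta> lam} \<Longrightarrow>
        \<bar>f t x lam\<bar> \<le> ereal (\<bar>x\<bar> / (a * (\<theta> lam - t)) + C lam)"
    and C_nonneg: "\<And>lam. lam > 0 \<Longrightarrow> C lam \<ge> 0"
    and C_cont: "continuous_on {0<..} C"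
begin

text \<open>
  The right-hand side as a real function. It represents \<open>f\<close> only for \<open>0 \<le> t < \<theta> lam\<close>; elsewhere
  an infinite value of \<open>f\<close> is turned into \<open>0\<close>.
\<close>

definition rhs :: "real \<Rightarrow> real \<Rightarrow> real \<Rightarrow> real"
  where "rhs t x lam = real_of_ereal (f t x lam)"

lemma f_eq_rhs: "lam > 0 \<Longrightarrow> t \<in> {0..<\<theta> lam} \<Longrightarrow> f t x lam = ereal (rhs t x lam)"
  using f_finite by (simp add: rhs_def ereal_real')

lemma rhs_lipschitz:
  assumes "lam > 0" "0 < \<epsilon>" "\<epsilon> < \<theta> lam" "t \<in> {0..\<theta> lam - \<epsilon>}"
  shows "\<bar>rhs t x lam - rhs t x' lam\<bar> \<le> L lam \<epsilon> * \<bar>x - x'\<bar>"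
  using lipschitz[OF assms, of x x'] assms by (simp add: f_eq_rhs)

lemma L_nonneg: "lam > 0 \<Longrightarrow> 0 < \<epsilon> \<Longrightarrow> \<epsilon> < \<theta> lam \<Longrightarrow> L lam \<epsilon> \<ge> 0"
  using rhs_lipschitz[of lam \<epsilon> 0 1 0] by simp

lemma rhs_growth:
  assumes "lam > 0" "t \<in> {0..<\<theta> lam}"
  shows "\<bar>rhs t x lam\<bar> \<le> \<bar>x\<bar> / (a * (\<theta> lam - t)) + C lam"
  using growth[OF assms, of x] assms by (simp add: f_eq_rhs)

lemma rhs_cont: "continuous_on {(t, x, lam). lam > 0 \<and> t \<in> {0..<\<theta> lam}} (\<lambda>(t, x, lam). rhs t x lam)"
proof -
  let ?S = "{(t, x, lam). lam > 0 \<and> t \<in> {0..<\<theta> lam}}"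
  have rhs_eq: "(\<lambda>(t, x, lam). rhs t x lam) = real_of_ereal \<circ> (\<lambda>(t, x, lam). f t x lam)"
    by (auto simp: rhs_def)
  have fin: "\<bar>(\<lambda>(t, x, lam). f t x lam) y\<bar> \<noteq> \<infinity>" if "y \<in> ?S" for y
  proof -
    obtain t x lam where y: "y = (t, x, lam)" by (cases y)
    show ?thesis using that f_finite[of lam t x] unfolding y by simp
  qed
  show ?thesis
    unfolding rhs_eq by (rule iffD1[OF continuous_on_iff_real[OF fin] f_cont])
qed

lemma rhs_cont_tx:
  assumes "lam > 0" "T < \<theta> lam"
  shows "continuous_on ({0..T} \<times> UNIV) (\<lambda>(t, x). rhs t x lam)"
proof -
  have "continuous_on ({0..T} \<times> UNIV) (\<lambda>y. (\<lambda>(t, x, lam). rhs t x lam) (fst y, snd y, lam))"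
    by (rule continuous_on_compose2[OF rhs_cont]) (use assms in \<open>auto intro!: continuous_intros\<close>)
  then show ?thesis by (simp add: case_prod_unfold)
qed

lemma eventually_theta_gt:
  assumes "lam > 0" "c < \<theta> lam"
  shows "eventually (\<lambda>mu. mu > 0 \<and> c < \<theta> mu) (nhds lam)"
proof -
  have "isCont \<theta> lam"
    using theta_cont assms(1) by (simp add: continuous_on_eq_continuous_at)
  then have "eventually (\<lambda>mu. c < \<theta> mu) (nhds lam)"
    using assms(2) by (intro order_tendstoD(1)) (auto simp: continuous_at tendsto_nhds_iff)
  moreover have "eventually (\<lambda>mu. mu > 0) (nhds lam)"
    using assms(1) eventually_nhds_in_open[of "{0<..}" lam] by simp
  ultimately show ?thesis by eventually_elim auto
qed

section \<open>Stability, uniqueness and existence of trajectories\<close>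

text \<open>
  Comparison of a trajectory for the parameter \<open>lam\<close> with one for \<open>mu\<close>, up to a time \<open>T\<close> at
  which the Lipschitz constant of \<open>f\<close> is still under control. With \<open>mu = lam\<close> it gives
  uniqueness, with \<open>lam\<close> close to \<open>mu\<close> continuous dependence on the parameter.
\<close>

lemma trajectory_stability:
  assumes lam: "lam > 0" "0 < \<epsilon>" "\<epsilon> < \<theta> lam" and T: "0 \<le> T" "T \<le> \<theta> lam - \<epsilon>"
    and u_cont: "continuous_on {0..T} u" and v_cont: "continuous_on {0..T} v"
    and u_deriv: "\<And>s. s \<in> {0<..<T} \<Longrightarrow> (u has_real_derivative rhs s (u s) lam) (at s)"
    and v_deriv: "\<And>s. s \<in> {0<..<T} \<Longrightarrow> (v has_real_derivative rhs s (v s) mu) (at s)"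
    and close: "\<And>s. s \<in> {0<..<T} \<Longrightarrow> \<bar>rhs s (v s) lam - rhs s (v s) mu\<bar> \<le> \<delta>" and "\<delta> \<ge> 0"
  shows "\<bar>u T - v T\<bar> \<le> exp (L lam \<epsilon> * T) * (\<bar>u 0 - v 0\<bar> + \<delta> * T)"
proof -
  have "\<bar>u T - v T\<bar> \<le> exp (L lam \<epsilon> * T - L lam \<epsilon> * 0) * (\<bar>u 0 - v 0\<bar> + \<delta> * (T - 0))"
  proof (rule gronwall_abs[where y = "\<lambda>s. u s - v s" and y' = "\<lambda>s. rhs s (u s) lam - rhs s (v s) mu"
        and K = "\<lambda>s. L lam \<epsilon> * s" and k = "\<lambda>s. L lam \<epsilon>"])
    fix s assume s: "s \<in> {0<..<T}"
    show "((\<lambda>s. u s - v s) has_real_derivative rhs s (u s) lam - rhs s (v s) mu) (at s)"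
      by (intro DERIV_diff u_deriv v_deriv s)
    show "((\<lambda>s. L lam \<epsilon> * s) has_real_derivative L lam \<epsilon>) (at s)"
      by (auto intro!: derivative_eq_intros)
    show "0 \<le> L lam \<epsilon>" by (intro L_nonneg lam)
    have "\<bar>rhs s (u s) lam - rhs s (v s) lam\<bar> \<le> L lam \<epsilon> * \<bar>u s - v s\<bar>"
      using s T by (intro rhs_lipschitz lam) auto
    with close[OF s] show "\<bar>rhs s (u s) lam - rhs s (v s) mu\<bar> \<le> L lam \<epsilon> * \<bar>u s - v s\<bar> + \<delta>"
      by linarith
  qed (use assms in \<open>auto intro!: continuous_intros\<close>)
  then show ?thesis by simp
qed

lemma trajectory_unique:
  assumes lam: "lam > 0" and T: "0 \<le> T" "T < \<theta> lam"
    and cont: "continuous_on {0..T} u" "continuous_on {0..T} v"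
    and deriv: "\<And>s. s \<in> {0<..<T} \<Longrightarrow> (u has_real_derivative rhs s (u s) lam) (at s)"
      "\<And>s. s \<in> {0<..<T} \<Longrightarrow> (v has_real_derivative rhs s (v s) lam) (at s)"
    and init: "u 0 = v 0"
  shows "u T = v T"
proof (cases "T = 0")
  case False
  then have "\<bar>u T - v T\<bar> \<le> exp (L lam (\<theta> lam - T) * T) * (\<bar>u 0 - v 0\<bar> + 0 * T)"
    using assms by (intro trajectory_stability[where mu = lam and u = u and v = v and T = T]) auto
  then show ?thesis by (simp add: init)
qed (use init in simp)

lemma ivp_solutionD:
  assumes "ivp_solution f \<theta> u0 lam u"
  shows "u 0 = u0 lam" "continuous_on {0..<\<theta> lam} u"
    and "T < \<theta> lam \<Longrightarrow> continuous_on {0..T} u"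
    and "0 < s \<Longrightarrow> s < \<theta> lam \<Longrightarrow> (u has_real_derivative rhs s (u s) lam) (at s)"
proof -
  show *: "continuous_on {0..<\<theta> lam} u" "u 0 = u0 lam" using assms by (auto simp: ivp_solution_def)
  show "T < \<theta> lam \<Longrightarrow> continuous_on {0..T} u"
    by (rule continuous_on_subset[OF *(1)]) auto
  assume s: "0 < s" "s < \<theta> lam"
  have "at s within {0..<\<theta> lam} = at s"
    using s by (intro at_within_interior) (auto simp: interior_open intro!: interiorI[of "{0<..<\<theta> lam}"])
  then show "(u has_real_derivative rhs s (u s) lam) (at s)"
    using assms s by (auto simp: ivp_solution_def rhs_def dest!: bspec[of _ _ s])
qed

lemma ivp_solution_unique:
  assumes "lam > 0" "ivp_solution f \<theta> u0 lam u" "ivp_solution f \<theta> u0 lam v" "t \<in> {0..<\<theta> lam}"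
  shows "u t = v t"
proof (rule trajectory_unique[OF assms(1), where u = u and v = v and T = t])
  show "continuous_on {0..t} u" "continuous_on {0..t} v"
    using assms(4) ivp_solutionD(3)[OF assms(2)] ivp_solutionD(3)[OF assms(3)] by auto
  show "u 0 = v 0" using ivp_solutionD(1)[OF assms(2)] ivp_solutionD(1)[OF assms(3)] by simp
  fix s assume "s \<in> {0<..<t}"
  then have s: "0 < s" "s < \<theta> lam" using assms(4) by auto
  show "(u has_real_derivative rhs s (u s) lam) (at s)" by (rule ivp_solutionD(4)[OF assms(2) s])
  show "(v has_real_derivative rhs s (v s) lam) (at s)" by (rule ivp_solutionD(4)[OF assms(3) s])
qed (use assms(4) in auto)

lemma ivp_solution_exists:
  assumes lam: "lam > 0"
  shows "\<exists>u. ivp_solution f \<theta> u0 lam u"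
proof -
  \<comment> \<open>The solutions \<open>w T\<close> on the intervals \<open>[0, T]\<close> extend one another by uniqueness, and \<open>u\<close> is their union.\<close>
  have "\<exists>w. w 0 = u0 lam \<and>
      (\<forall>t\<in>{0..T}. (w has_real_derivative rhs t (w t) lam) (at t within {0..T}))"
    if "T \<in> {0<..<\<theta> lam}" for T
    by (rule picard_lindelof_Icc[of 0 T "L lam (\<theta> lam - T)" "\<lambda>t x. rhs t x lam" "u0 lam"])
       (use that lam in \<open>auto intro!: L_nonneg rhs_cont_tx rhs_lipschitz\<close>)
  then obtain w where w0: "w T 0 = u0 lam"
    and w_deriv: "t \<in> {0..T} \<Longrightarrow> (w T has_real_derivative rhs t (w T t) lam) (at t within {0..T})"
    if "T \<in> {0<..<\<theta> lam}" for T t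
    by metis
  have w_cont: "continuous_on {0..S} (w T)" if "T \<in> {0<..<\<theta> lam}" "S \<le> T" for S T
    by (rule continuous_on_subset[OF DERIV_continuous_on[OF w_deriv[OF that(1)]]]) (use that in auto)
  have w_deriv_at: "(w T has_real_derivative rhs t (w T t) lam) (at t)"
    if "T \<in> {0<..<\<theta> lam}" "t \<in> {0<..<T}" for t T
    using w_deriv[OF that(1), of t] that(2) by (simp add: at_within_Icc_at)
  have agree: "w S t = w T t"
    if "S \<in> {0<..<\<theta> lam}" "T \<in> {0<..<\<theta> lam}" "0 \<le> t" "t \<le> S" "t \<le> T" for S T t
    using that by (intro trajectory_unique[OF lam, where u = "w S" and v = "w T" and T = t] w_cont w_deriv_at) (auto simp: w0)
  define half where "half t = (t + \<theta> lam) / 2" for t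
  have half: "half t \<in> {0<..<\<theta> lam}" "t < half t" if "t \<in> {0..<\<theta> lam}" for t
    using that by (auto simp: half_def)
  define u where "u t = w (half t) t" for t
  have u_eq: "u t = w T t" if "T \<in> {0<..<\<theta> lam}" "t \<in> {0..T}" for t T
    unfolding u_def using that half[of t] by (intro agree) auto
  have u_deriv: "(u has_real_derivative rhs t (u t) lam) (at t within {0..<\<theta> lam})"
    if t: "t \<in> {0..<\<theta> lam}" for t
  proof -
    have w_eq_u: "w (half t) x = u x" if "x \<in> {0..half t}" for x
      using u_eq[OF half(1)[OF t] that] by simp
    have "(u has_real_derivative rhs t (w (half t) t) lam) (at t within {0..half t})"
      by (rule has_field_derivative_transform_within[OF w_deriv[OF half(1)[OF t], of t] zero_less_one])
         (use t half[OF t] in \<open>auto intro: w_eq_u\<close>)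
    moreover have "at t within {0..half t} = at t within {0..<\<theta> lam}"
      by (rule at_within_nhd[of _ "{..<half t}"]) (use half[OF t] in auto)
    ultimately show ?thesis by (simp add: u_def)
  qed
  have "ivp_solution f \<theta> u0 lam u"
    unfolding ivp_solution_def
    using u_deriv DERIV_continuous_on[of "{0..<\<theta> lam}" u, OF u_deriv] w0[OF half(1)[of 0]] theta_pos[OF lam]
    by (auto simp: u_def rhs_def)
  then show ?thesis by blast
qed

lemma ivp_sol_solves:
  assumes lam: "lam > 0"
  shows "ivp_solution f \<theta> u0 lam (ivp_sol f \<theta> u0 lam)"
proof -
  obtain u where u: "ivp_solution f \<theta> u0 lam u" using ivp_solution_exists[OF lam] by blast
  define v where "v = restrict u {0..<\<theta> lam}"
  have v_eq: "v t = u t" if "t \<in> {0..<\<theta> lam}" for t using that by (simp add: v_def)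
  have v: "ivp_solution f \<theta> u0 lam v"
    unfolding ivp_solution_def
  proof (intro conjI ballI)
    show "continuous_on {0..<\<theta> lam} v" using ivp_solutionD(2)[OF u] by (subst continuous_on_cong[OF refl v_eq])
    show "v 0 = u0 lam" using ivp_solutionD(1)[OF u] theta_pos[OF lam] by (simp add: v_eq)
    fix t assume t: "t \<in> {0..<\<theta> lam}"
    then have "(u has_real_derivative real_of_ereal (f t (u t) lam)) (at t within {0..<\<theta> lam})"
      using u by (auto simp: ivp_solution_def)
    then show "(v has_real_derivative real_of_ereal (f t (v t) lam)) (at t within {0..<\<theta> lam})"
      unfolding v_eq[OF t]
      by (rule has_field_derivative_transform_within[OF _ zero_less_one t]) (simp add: v_eq)
  qed
  have "\<exists>!u. u \<in> extensional {0..<\<theta> lam} \<and> ivp_solution f \<theta> u0 lam u"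
  proof (rule ex1I)
    show "v \<in> extensional {0..<\<theta> lam} \<and> ivp_solution f \<theta> u0 lam v"
      using v by (simp add: v_def)
    fix w assume w: "w \<in> extensional {0..<\<theta> lam} \<and> ivp_solution f \<theta> u0 lam w"
    show "w = v"
    proof (rule extensionalityI)
      show "w \<in> extensional {0..<\<theta> lam}" "v \<in> extensional {0..<\<theta> lam}"
        using w by (simp_all add: v_def)
      show "w t = v t" if "t \<in> {0..<\<theta> lam}" for t
        using ivp_solution_unique[OF lam _ v that] w by blast
    qed
  qed
  from theI'[OF this] show ?thesis unfolding ivp_sol_def by (rule conjunct2)
qed

lemma sol_init: "lam > 0 \<Longrightarrow> ivp_sol f \<theta> u0 lam 0 = u0 lam"
  by (rule ivp_solutionD(1)[OF ivp_sol_solves])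

lemma sol_cont: "lam > 0 \<Longrightarrow> T < \<theta> lam \<Longrightarrow> continuous_on {0..T} (ivp_sol f \<theta> u0 lam)"
  by (rule ivp_solutionD(3)[OF ivp_sol_solves])

lemma sol_deriv:
  "lam > 0 \<Longrightarrow> 0 < s \<Longrightarrow> s < \<theta> lam \<Longrightarrow>
    (ivp_sol f \<theta> u0 lam has_real_derivative rhs s (ivp_sol f \<theta> u0 lam s) lam) (at s)"
  by (rule ivp_solutionD(4)[OF ivp_sol_solves])

section \<open>Growth of trajectories near the final time\<close>

text \<open>
  The factor in the bound for the trajectory near the final time that follows from the growth condition.
\<close>

definition amplitude :: "real \<Rightarrow> real"
  where "amplitude lam = \<theta> lam powr (1/a) * (\<bar>u0 lam\<bar> + C lam * \<theta> lam)"

lemma amplitude_nonneg: "lam > 0 \<Longrightarrow> amplitude lam \<ge> 0"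
  using C_nonneg theta_pos by (simp add: amplitude_def less_imp_le)

text \<open>
  The singularity at the final time is integrable because \<open>a > 1\<close>. The bound is
  Gronwall's inequality with the kernel \<open>1 / (a * (\<theta> lam - s))\<close>, whose primitive is logarithmic.
\<close>

lemma sol_bound:
  assumes lam: "lam > 0" and t: "t \<in> {0..<\<theta> lam}"
  shows "\<bar>ivp_sol f \<theta> u0 lam t\<bar> \<le> amplitude lam * (\<theta> lam - t) powr (- 1/a)"
proof -
  define K where "K s = - ln (\<theta> lam - s) / a" for s
  have "\<bar>ivp_sol f \<theta> u0 lam t\<bar> \<le> exp (K t - K 0) * (\<bar>ivp_sol f \<theta> u0 lam 0\<bar> + C lam * (t - 0))"
  proof (rule gronwall_abs[where K = K and k = "\<lambda>s. 1 / (a * (\<theta> lam - s))"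
        and y' = "\<lambda>s. rhs s (ivp_sol f \<theta> u0 lam s) lam"])
    show "continuous_on {0..t} K"
      unfolding K_def using t a_gt_1 by (intro continuous_intros) auto
    fix s assume s: "s \<in> {0<..<t}"
    show "(ivp_sol f \<theta> u0 lam has_real_derivative rhs s (ivp_sol f \<theta> u0 lam s) lam) (at s)"
      using s t by (intro sol_deriv lam) auto
    show "(K has_real_derivative 1 / (a * (\<theta> lam - s))) (at s)"
      unfolding K_def using s t a_gt_1 by (auto intro!: derivative_eq_intros simp: divide_simps)
    show "0 \<le> 1 / (a * (\<theta> lam - s))" using s t a_gt_1 by auto
    show "\<bar>rhs s (ivp_sol f \<theta> u0 lam s) lam\<bar> \<le> 1 / (a * (\<theta> lam - s)) * \<bar>ivp_sol f \<theta> u0 lam s\<bar> + C lam"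
      using rhs_growth[OF lam, of s "ivp_sol f \<theta> u0 lam s"] s t by simp
  qed (use t C_nonneg[OF lam] sol_cont[OF lam] in auto)
  also have "\<dots> \<le> exp (K t - K 0) * (\<bar>u0 lam\<bar> + C lam * \<theta> lam)"
    using t C_nonneg[OF lam] by (intro mult_left_mono add_mono) (auto simp: sol_init lam mult_left_mono)
  also have "exp (K t - K 0) = \<theta> lam powr (1/a) * (\<theta> lam - t) powr (- 1/a)"
    using t by (simp add: K_def powr_def diff_divide_distrib flip: exp_add)
  finally show ?thesis by (simp add: amplitude_def mult_ac)
qed

text \<open>
  The integral of \<open>amplitude lam * (\<theta> lam - x) powr (- 1/a)\<close> over \<open>x \<in> [t, \<theta> lam)\<close>, for \<open>t \<le> \<theta> lam\<close>.
\<close>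

definition tail :: "real \<Rightarrow> real \<Rightarrow> real"
  where "tail lam t = amplitude lam * (\<theta> lam - t) powr (1 - 1/a) / (1 - 1/a)"

lemma exponent_pos: "1 - 1/a > 0" using a_gt_1 by simp

lemma tail_nonneg: "lam > 0 \<Longrightarrow> tail lam t \<ge> 0"
  using amplitude_nonneg exponent_pos by (simp add: tail_def)

lemma tail_cont_t: "continuous_on {..\<theta> lam} (tail lam)"
  unfolding tail_def using exponent_pos by (intro continuous_intros continuous_on_powr') auto

lemma tail_cont_lam:
  assumes "lam > 0" "t < \<theta> lam"
  shows "isCont (\<lambda>mu. tail mu t) lam"
proof -
  have "isCont \<theta> lam" "isCont u0 lam" "isCont C lam"
    using theta_cont u0_cont C_cont assms(1) by (simp_all add: continuous_on_eq_continuous_at)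
  then show ?thesis
    unfolding tail_def amplitude_def using assms theta_pos[OF assms(1)] exponent_pos
    by (intro continuous_intros) auto
qed

lemma sol_integrable: "lam > 0 \<Longrightarrow> 0 \<le> s \<Longrightarrow> t < \<theta> lam \<Longrightarrow> ivp_sol f \<theta> u0 lam integrable_on {s..t}"
  by (rule integrable_continuous_real, rule continuous_on_subset[OF sol_cont[where lam = lam and T = t]]) auto

lemma integral_sol_increment:
  assumes lam: "lam > 0" and st: "0 \<le> s" "s \<le> t" "t < \<theta> lam"
  shows "\<bar>integral {0..t} (ivp_sol f \<theta> u0 lam) - integral {0..s} (ivp_sol f \<theta> u0 lam)\<bar>
      \<le> tail lam s - tail lam t"
proof -
  let ?u = "ivp_sol f \<theta> u0 lam"
  have int: "((\<lambda>x. amplitude lam * (\<theta> lam - x) powr (- 1/a)) has_integral (- tail lam t - (- tail lam s))) {s..t}"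
  proof (rule fundamental_theorem_of_calculus)
    fix x assume x: "x \<in> {s..t}"
    have "((\<lambda>x. (\<theta> lam - x) powr (1 - 1/a)) has_real_derivative
        (1 - 1/a) * (\<theta> lam - x) powr (1 - 1/a - of_nat 1) * (0 - 1)) (at x)"
      using x st by (intro DERIV_fun_powr DERIV_diff DERIV_const DERIV_ident) auto
    then have "((\<lambda>x. - (amplitude lam / (1 - 1/a)) * (\<theta> lam - x) powr (1 - 1/a)) has_real_derivative
        - (amplitude lam / (1 - 1/a)) * ((1 - 1/a) * (\<theta> lam - x) powr (1 - 1/a - of_nat 1) * (0 - 1))) (at x)"
      by (rule DERIV_cmult)
    then have "((\<lambda>x. - tail lam x) has_real_derivative amplitude lam * (\<theta> lam - x) powr (- 1/a)) (at x)"
      using a_gt_1 by (simp add: tail_def)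
    then have "((\<lambda>x. - tail lam x) has_real_derivative amplitude lam * (\<theta> lam - x) powr (- 1/a)) (at x within {s..t})"
      by (rule has_field_derivative_at_within)
    then show "((\<lambda>x. - tail lam x) has_vector_derivative amplitude lam * (\<theta> lam - x) powr (- 1/a)) (at x within {s..t})"
      by (simp add: has_real_derivative_iff_has_vector_derivative)
  qed fact
  have "norm (integral {s..t} ?u) \<le> integral {s..t} (\<lambda>x. amplitude lam * (\<theta> lam - x) powr (- 1/a))"
  proof (rule Henstock_Kurzweil_Integration.integral_norm_bound_integral)
    show "?u integrable_on {s..t}" by (rule sol_integrable[OF lam st(1,3)])
    show "(\<lambda>x. amplitude lam * (\<theta> lam - x) powr (- 1/a)) integrable_on {s..t}"
      by (rule has_integral_integrable[OF int])
    show "norm (?u x) \<le> amplitude lam * (\<theta> lam - x) powr (- 1/a)" if "x \<in> {s..t}" for x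
      unfolding real_norm_def by (rule sol_bound[OF lam]) (use that st in auto)
  qed
  also have "integral {s..t} (\<lambda>x. amplitude lam * (\<theta> lam - x) powr (- 1/a)) = - tail lam t - (- tail lam s)"
    by (rule integral_unique[OF int])
  finally have "norm (integral {s..t} ?u) \<le> tail lam s - tail lam t" by linarith
  moreover have "integral {0..s} ?u + integral {s..t} ?u = integral {0..t} ?u"
    using st by (intro Henstock_Kurzweil_Integration.integral_combine sol_integrable[OF lam]) auto
  ultimately show ?thesis unfolding real_norm_def by linarith
qed

text \<open>
  Since the integral of the trajectory up to time \<open>t\<close> is uniformly continuous in \<open>t\<close>, the improper
  integral exists; \<open>tail\<close> bounds the error made by stopping at time \<open>T\<close>. The bound is explicit and
  continuous in the parameter, hence small simultaneously for all nearby parameters.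
\<close>

lemma control_map_tail:
  assumes lam: "lam > 0" and T: "0 \<le> T" "T < \<theta> lam"
  shows "\<bar>control_map f \<theta> u0 lam - integral {0..T} (ivp_sol f \<theta> u0 lam)\<bar> \<le> tail lam T"
proof -
  define I where "I t = integral {0..t} (ivp_sol f \<theta> u0 lam)" for t
  have incr: "\<bar>I t - I s\<bar> \<le> \<bar>tail lam t - tail lam s\<bar>" if "s \<in> {0..<\<theta> lam}" "t \<in> {0..<\<theta> lam}" for s t
    using integral_sol_increment[OF lam, of s t] integral_sol_increment[OF lam, of t s] that
    by (cases "s \<le> t") (auto simp: I_def abs_minus_commute)
  have tail_uc: "uniformly_continuous_on {0..\<theta> lam} (tail lam)"
    by (intro compact_uniformly_continuous continuous_on_subset[OF tail_cont_t]) auto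
  have "uniformly_continuous_on {0..<\<theta> lam} I"
    unfolding uniformly_continuous_on_def
  proof (intro allI impI)
    fix e :: real assume "e > 0"
    then obtain d where d: "d > 0" and
      close: "\<And>s t. s \<in> {0..\<theta> lam} \<Longrightarrow> t \<in> {0..\<theta> lam} \<Longrightarrow> dist t s < d \<Longrightarrow> dist (tail lam t) (tail lam s) < e"
      using tail_uc unfolding uniformly_continuous_on_def by metis
    have "dist (I t) (I s) < e" if "s \<in> {0..<\<theta> lam}" "t \<in> {0..<\<theta> lam}" "dist t s < d" for s t
      using close[of s t] incr[of s t] that by (simp add: dist_real_def)
    with d show "\<exists>d>0. \<forall>s\<in>{0..<\<theta> lam}. \<forall>t\<in>{0..<\<theta> lam}. dist t s < d \<longrightarrow> dist (I t) (I s) < e"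
      by blast
  qed
  moreover have "\<theta> lam \<in> closure {0..<\<theta> lam}" using theta_pos[OF lam] by simp
  ultimately obtain l where "(I \<longlongrightarrow> l) (at (\<theta> lam) within {0..<\<theta> lam})"
    using uniformly_continuous_on_extension_at_closure by blast
  moreover have "at (\<theta> lam) within {0..<\<theta> lam} = at_left (\<theta> lam)"
    using theta_pos[OF lam] by (intro at_within_nhd[of _ "{0<..}"]) auto
  ultimately have l: "(I \<longlongrightarrow> l) (at_left (\<theta> lam))" by simp
  then have cm: "control_map f \<theta> u0 lam = l"
    unfolding control_map_def I_def by (intro tendsto_Lim) auto
  have "((\<lambda>t. \<bar>I t - I T\<bar>) \<longlongrightarrow> \<bar>l - I T\<bar>) (at_left (\<theta> lam))"
    by (intro tendsto_intros l)
  moreover have "eventually (\<lambda>t. \<bar>I t - I T\<bar> \<le> tail lam T) (at_left (\<theta> lam))"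
    using eventually_at_left_real[OF T(2)]
  proof eventually_elim
    case (elim t)
    then show ?case
      using integral_sol_increment[OF lam, of T t] T tail_nonneg[OF lam, of t] by (simp add: I_def)
  qed
  ultimately have "\<bar>l - I T\<bar> \<le> tail lam T" by (rule tendsto_upperbound) simp
  then show ?thesis by (simp add: cm I_def)
qed

section \<open>Continuity of the control map\<close>

text \<open>
  Up to a fixed time before the final time, trajectories depend continuously on the
  parameter. The trajectory for \<open>lam0\<close>, inserted into the equation for a nearby parameter, leaves
  a defect that is small uniformly in time because \<open>[0, T]\<close> is compact.
\<close>

lemma integral_sol_cont:
  assumes lam0: "lam0 > 0" and T: "0 \<le> T" "T < \<theta> lam0"
  shows "isCont (\<lambda>lam. integral {0..T} (ivp_sol f \<theta> u0 lam)) lam0"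
  unfolding isCont_def tendsto_iff dist_real_def
proof (intro allI impI)
  fix e :: real assume e: "e > 0"
  let ?v = "ivp_sol f \<theta> u0 lam0"
  define \<epsilon> where "\<epsilon> = (\<theta> lam0 - T) / 2"
  have \<epsilon>: "\<epsilon> > 0" "T + \<epsilon> < \<theta> lam0" using T by (auto simp: \<epsilon>_def field_simps)
  \<comment> \<open>\<open>M \<delta> lam\<close> bounds the difference of the integrals when the defect is at most \<open>\<delta>\<close>; \<open>\<delta>\<close> is chosen to make \<open>M \<delta> lam0 < e\<close>.\<close>
  define M where "M \<delta> lam = T * (exp (L lam \<epsilon> * T) * (\<bar>u0 lam - u0 lam0\<bar> + \<delta> * T))" for \<delta> lam
  define \<delta> where "\<delta> = e / (T * (exp (L lam0 \<epsilon> * T) * T) + 1)"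
  have den: "T * (exp (L lam0 \<epsilon> * T) * T) + 1 > 0" using T by (intro add_nonneg_pos) auto
  have \<delta>: "\<delta> > 0" using e den by (simp add: \<delta>_def)
  have "M \<delta> lam0 = e * (T * (exp (L lam0 \<epsilon> * T) * T)) / (T * (exp (L lam0 \<epsilon> * T) * T) + 1)"
    by (simp add: M_def \<delta>_def mult_ac)
  also have "\<dots> < e" using e den by (simp add: divide_less_eq)
  finally have M_less: "M \<delta> lam0 < e" .
  have near: "eventually (\<lambda>lam. lam > 0 \<and> T + \<epsilon> < \<theta> lam) (at lam0)"
    using eventually_theta_gt[OF lam0 \<epsilon>(2)]
    by (auto simp: eventually_at_filter elim: eventually_mono)
  have "isCont u0 lam0"
    using u0_cont lam0 by (simp add: continuous_on_eq_continuous_at)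
  moreover have "isCont (\<lambda>lam. L lam \<epsilon>) lam0"
  proof (rule continuous_on_interior[OF L_cont[OF \<epsilon>(1)]])
    have "eventually (\<lambda>lam. lam > 0 \<and> \<epsilon> < \<theta> lam) (nhds lam0)"
      using \<epsilon> T by (intro eventually_theta_gt lam0) auto
    then obtain S where "open S" "lam0 \<in> S" "S \<subseteq> {lam. 0 < lam \<and> \<epsilon> < \<theta> lam}"
      by (auto simp: eventually_nhds)
    then show "lam0 \<in> interior {lam. 0 < lam \<and> \<epsilon> < \<theta> lam}" by (rule interiorI)
  qed
  ultimately have "isCont (M \<delta>) lam0" unfolding M_def by (intro continuous_intros)
  then have M_ev: "eventually (\<lambda>lam. M \<delta> lam < e) (at lam0)"
    unfolding isCont_def using M_less by (rule order_tendstoD(2))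
  have v_cont: "continuous_on {0..T} ?v" using T by (intro sol_cont lam0)
  have "continuous_on ({lam. lam > 0 \<and> T < \<theta> lam} \<times> {0..T})
      (\<lambda>y. (\<lambda>(t, x, lam). rhs t x lam) (snd y, ?v (snd y), fst y))"
    by (rule continuous_on_compose2[OF rhs_cont])
       (auto intro!: continuous_intros continuous_on_compose2[OF v_cont])
  then obtain X where X: "lam0 \<in> X" "open X" and
    X_close: "\<And>lam s. lam \<in> X \<Longrightarrow> lam > 0 \<Longrightarrow> T < \<theta> lam \<Longrightarrow> s \<in> {0..T} \<Longrightarrow>
      \<bar>rhs s (?v s) lam - rhs s (?v s) lam0\<bar> \<le> \<delta>"
    by (rule continuous_on_prod_compactE[of _ _ _ lam0 \<delta>])
       (use T lam0 \<delta> in \<open>auto simp: dist_real_def\<close>)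
  have "eventually (\<lambda>lam. lam \<in> X) (at lam0)" using X by (simp add: eventually_at_in_open')
  with near M_ev show "eventually (\<lambda>lam. \<bar>integral {0..T} (ivp_sol f \<theta> u0 lam) - integral {0..T} ?v\<bar> < e) (at lam0)"
  proof eventually_elim
    case (elim lam)
    let ?u = "ivp_sol f \<theta> u0 lam"
    have lam: "lam > 0" "\<epsilon> < \<theta> lam" "T + \<epsilon> < \<theta> lam" using elim T by auto
    have pointwise: "\<bar>?u t - ?v t\<bar> \<le> exp (L lam \<epsilon> * T) * (\<bar>u0 lam - u0 lam0\<bar> + \<delta> * T)"
      if t: "t \<in> {0..T}" for t
    proof -
      have "\<bar>?u t - ?v t\<bar> \<le> exp (L lam \<epsilon> * t) * (\<bar>?u 0 - ?v 0\<bar> + \<delta> * t)"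
        using t T \<epsilon> lam lam0 elim \<delta>
        by (intro trajectory_stability[where mu = lam0 and u = ?u and v = ?v and T = t] sol_cont sol_deriv X_close) auto
      also have "\<dots> \<le> exp (L lam \<epsilon> * T) * (\<bar>u0 lam - u0 lam0\<bar> + \<delta> * T)"
        using t \<delta> L_nonneg[OF lam(1) \<epsilon>(1) lam(2)]
        by (intro mult_mono add_mono) (auto simp: sol_init lam lam0 mult_left_mono)
      finally show ?thesis .
    qed
    have "integral {0..T} ?u - integral {0..T} ?v = integral {0..T} (\<lambda>t. ?u t - ?v t)"
      using lam lam0 T \<epsilon> by (intro integral_diff[symmetric] sol_integrable) auto
    also have "norm \<dots> \<le> (exp (L lam \<epsilon> * T) * (\<bar>u0 lam - u0 lam0\<bar> + \<delta> * T)) * (T - 0)"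
      using T lam lam0 \<epsilon> pointwise
      by (intro integral_bound continuous_on_diff sol_cont) auto
    also have "\<dots> = M \<delta> lam" by (simp add: M_def)
    finally show ?case using elim by simp
  qed
qed

lemma control_map_cont: "continuous_on {0<..} (control_map f \<theta> u0)"
proof -
  have "isCont (control_map f \<theta> u0) lam0" if lam0: "lam0 > 0" for lam0
    unfolding isCont_def tendsto_iff dist_real_def
  proof (intro allI impI)
    fix e :: real assume e: "e > 0"
    have "(tail lam0 \<longlongrightarrow> tail lam0 (\<theta> lam0)) (at (\<theta> lam0) within {..\<theta> lam0})"
      using tail_cont_t[of lam0] by (auto simp: continuous_on_def)
    then have "(tail lam0 \<longlongrightarrow> 0) (at_left (\<theta> lam0))"
      by (rule tendsto_within_subset[of _ _ _ "{..\<theta> lam0}", THEN tendsto_eq_rhs]) (auto simp: tail_def)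
    then have "eventually (\<lambda>t. tail lam0 t < e/3) (at_left (\<theta> lam0))"
      using e by (intro order_tendstoD(2)) auto
    then have "eventually (\<lambda>t. tail lam0 t < e/3 \<and> t \<in> {0<..<\<theta> lam0}) (at_left (\<theta> lam0))"
      using eventually_at_left_real[OF theta_pos[OF lam0]] by eventually_elim auto
    then obtain T where T: "tail lam0 T < e/3" "0 < T" "T < \<theta> lam0"
      using eventually_happens' trivial_limit_at_left_real by (metis (no_types, lifting) greaterThanLessThan_iff)
    let ?I = "\<lambda>lam. integral {0..T} (ivp_sol f \<theta> u0 lam)"
    have "eventually (\<lambda>lam. tail lam T < e/3) (at lam0)"
      using tail_cont_lam[OF lam0 T(3)] T(1) unfolding isCont_def by (rule order_tendstoD(2))
    moreover have "eventually (\<lambda>lam. \<bar>?I lam - ?I lam0\<bar> < e/3) (at lam0)"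
      using integral_sol_cont[OF lam0, of T] T e unfolding isCont_def
      by (auto simp: tendsto_iff dist_real_def dest!: spec[of _ "e/3"])
    moreover have "eventually (\<lambda>lam. lam > 0 \<and> T < \<theta> lam) (at lam0)"
      using eventually_theta_gt[OF lam0 T(3)]
      by (auto simp: eventually_at_filter elim: eventually_mono)
    ultimately show "eventually (\<lambda>lam. \<bar>control_map f \<theta> u0 lam - control_map f \<theta> u0 lam0\<bar> < e) (at lam0)"
    proof eventually_elim
      case (elim lam)
      then show ?case
        using control_map_tail[of lam T] control_map_tail[OF lam0, of T] T by linarith
    qed
  qed
  then show ?thesis by (simp add: continuous_at_imp_continuous_on)
qed

end

section \<open>Convergence of bisection\<close>

text \<open>
  No order between \<open>l\<close> and \<open>h\<close> is needed: every step that does not stop keeps \<open>\<phi> < p\<close> at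
  the first parameter, \<open>\<phi> > p\<close> at the second one, and halves their distance.
\<close>

lemma bisection_converges:
  fixes \<phi> :: "real \<Rightarrow> real" and p l h :: real
  assumes cont: "continuous_on (closed_segment l h) \<phi>"
    and l: "\<phi> l < p" and h: "\<phi> h > p"
  shows "(\<exists>k m. bisection \<phi> p l h k = Stopped m \<and> m \<in> closed_segment l h \<and> \<phi> m = p) \<or>
    (\<exists>lo hi m. (\<forall>k. bisection \<phi> p l h k = Running (lo k) (hi k)) \<and>
       lo \<longlonglongrightarrow> m \<and> hi \<longlonglongrightarrow> m \<and> m \<in> closed_segment l h \<and> \<phi> m = p)"
proof -
  define S where "S = closed_segment l h"
  have mid: "(x + y) / 2 \<in> S" if "x \<in> S" "y \<in> S" for x y
    using convexD[OF convex_closed_segment that[unfolded S_def], of "1/2" "1/2"]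
    by (simp add: S_def field_simps)
  define inv where "inv k s = (case s of
      Running x y \<Rightarrow> x \<in> S \<and> y \<in> S \<and> \<phi> x < p \<and> \<phi> y > p \<and> \<bar>y - x\<bar> = \<bar>h - l\<bar> / 2 ^ k
    | Stopped m \<Rightarrow> m \<in> S \<and> \<phi> m = p)" for k :: nat and s
  have bis_Suc: "bisection \<phi> p l h (Suc k) = bisection_step \<phi> p (bisection \<phi> p l h k)" for k
    by (simp add: bisection_def)
  have inv: "inv k (bisection \<phi> p l h k)" for k
  proof (induction k)
    case 0
    show ?case using l h by (simp add: inv_def bisection_def S_def)
  next
    case (Suc k)
    show ?case
    proof (cases "bisection \<phi> p l h k")
      case (Running x y)
      have "\<bar>y - (x + y) / 2\<bar> = \<bar>y - x\<bar> / 2" "\<bar>(x + y) / 2 - x\<bar> = \<bar>y - x\<bar> / 2"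
        by (simp_all add: field_simps abs_if)
      then show ?thesis
        using Suc Running mid by (auto simp: bis_Suc inv_def Let_def)
    next
      case (Stopped m)
      then show ?thesis using Suc by (simp add: bis_Suc inv_def)
    qed
  qed
  show ?thesis
  proof (cases "\<exists>k m. bisection \<phi> p l h k = Stopped m")
    case True
    then obtain k m where stop: "bisection \<phi> p l h k = Stopped m" by blast
    with inv[of k] have "m \<in> closed_segment l h" "\<phi> m = p" by (simp_all add: inv_def S_def)
    with stop show ?thesis by blast
  next
    case False
    then have "\<forall>k. \<exists>x y. bisection \<phi> p l h k = Running x y"
      by (metis bisection_state.exhaust)
    then obtain lo hi where run: "bisection \<phi> p l h k = Running (lo k) (hi k)" for k
      by metis
    have lohi: "lo k \<in> S" "hi k \<in> S" "\<phi> (lo k) < p" "\<phi> (hi k) > p"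
      and gap: "\<bar>hi k - lo k\<bar> = \<bar>h - l\<bar> / 2 ^ k" for k
      using inv[of k] by (auto simp: run inv_def)
    \<comment> \<open>The increments of \<open>lo\<close> are dominated by a geometric series, and the distance of \<open>hi\<close> to \<open>lo\<close> vanishes.\<close>
    have geo: "summable (\<lambda>k. \<bar>h - l\<bar> * (1/2) ^ k)"
      by (intro summable_mult summable_geometric) auto
    have step: "\<bar>lo (Suc k) - lo k\<bar> \<le> \<bar>h - l\<bar> * (1/2) ^ k" for k
    proof -
      have "lo (Suc k) = lo k \<or> lo (Suc k) = (lo k + hi k) / 2"
        using bis_Suc[of k] by (auto simp: run Let_def split: if_splits)
      then have "\<bar>lo (Suc k) - lo k\<bar> \<le> \<bar>hi k - lo k\<bar>"
        by (auto simp: field_simps)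
      then show ?thesis by (simp add: gap power_one_over field_simps)
    qed
    have "summable (\<lambda>k. lo (Suc k) - lo k)"
      by (rule summable_comparison_test'[OF geo, of 0]) (use step in auto)
    then have "convergent (\<lambda>n. lo n - lo 0)"
      by (simp add: summable_iff_convergent sum_lessThan_telescope)
    then obtain m0 where "(\<lambda>n. lo n - lo 0) \<longlonglongrightarrow> m0" by (auto simp: convergent_def)
    then have lo_lim: "lo \<longlonglongrightarrow> lo 0 + m0"
      by (auto dest: tendsto_add[OF tendsto_const[of "lo 0"]])
    define m where "m = lo 0 + m0"
    have "(\<lambda>k. \<bar>h - l\<bar> * (1/2) ^ k) \<longlonglongrightarrow> 0" by (rule summable_LIMSEQ_zero[OF geo])
    then have "(\<lambda>k. \<bar>hi k - lo k\<bar>) \<longlonglongrightarrow> 0" by (simp add: gap power_one_over field_simps)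
    then have "(\<lambda>k. hi k - lo k) \<longlonglongrightarrow> 0" by (simp only: tendsto_rabs_zero_iff)
    from tendsto_add[OF this lo_lim] have hi_lim: "hi \<longlonglongrightarrow> m" by (simp add: m_def)
    have m: "m \<in> S"
      unfolding m_def
      by (rule closed_sequentially[OF _ _ lo_lim]) (use lohi in \<open>auto simp: S_def\<close>)
    have "(\<lambda>k. \<phi> (lo k)) \<longlonglongrightarrow> \<phi> m" "(\<lambda>k. \<phi> (hi k)) \<longlonglongrightarrow> \<phi> m"
      using cont m lohi lo_lim hi_lim
      by (auto intro!: continuous_on_tendsto_compose[of S \<phi>] simp: S_def m_def)
    then have "\<phi> m \<le> p" "\<phi> m \<ge> p"
      using lohi(3,4)[THEN less_imp_le] by (auto intro: LIMSEQ_le_const2 LIMSEQ_le_const)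
    then have "\<phi> m = p" by simp
    then show ?thesis using run lo_lim hi_lim m unfolding S_def m_def by blast
  qed
qed

theorem theorem3p1:
  fixes \<theta> u0 C :: "real \<Rightarrow> real"
    and f :: "real \<Rightarrow> real \<Rightarrow> real \<Rightarrow> ereal"
    and L :: "real \<Rightarrow> real \<Rightarrow> real"
    and a p lam_lo lam_hi :: real
  defines "\<phi> \<equiv> control_map f \<theta> u0"
  assumes theta_pos: "\<And>lam. lam > 0 \<Longrightarrow> \<theta> lam > 0"
    and f_finite: "\<And>lam t x. lam > 0 \<Longrightarrow> t \<in> {0..<\<theta> lam} \<Longrightarrow> \<bar>f t x lam\<bar> \<noteq> \<infinity>"
    and f_blowup: "\<And>lam. lam > 0 \<Longrightarrow>
        AE x in lborel. ((\<lambda>t. f t x lam) \<longlongrightarrow> \<infinity>) (at_left (\<theta> lam)) \<or>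
                        ((\<lambda>t. f t x lam) \<longlongrightarrow> - \<infinity>) (at_left (\<theta> lam))"
    and lipschitz: "\<And>lam \<epsilon> t x x'. lam > 0 \<Longrightarrow> 0 < \<epsilon> \<Longrightarrow> \<epsilon> < \<theta> lam \<Longrightarrow> t \<in> {0..\<theta> lam - \<epsilon>} \<Longrightarrow>
        \<bar>f t x lam - f t x' lam\<bar> \<le> ereal (L lam \<epsilon> * \<bar>x - x'\<bar>)"
    and theta_cont: "continuous_on {0<..} \<theta>"
    and u0_cont: "continuous_on {0<..} u0"
    and L_cont: "\<And>\<epsilon>. \<epsilon> > 0 \<Longrightarrow> continuous_on {lam. lam > 0 \<and> \<theta> lam > \<epsilon>} (\<lambda>lam. L lam \<epsilon>)"
    and f_cont: "continuous_on {(t, x, lam). lam > 0 \<and> t \<in> {0..<\<theta> lam}} (\<lambda>(t, x, lam). f t x lam)"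
    and a_gt_1: "a > 1"
    and growth: "\<And>lam t x. lam > 0 \<Longrightarrow> t \<in> {0..<\<theta> lam} \<Longrightarrow>
        \<bar>f t x lam\<bar> \<le> ereal (\<bar>x\<bar> / (a * (\<theta> lam - t)) + C lam)"
    and C_nonneg: "\<And>lam. lam > 0 \<Longrightarrow> C lam \<ge> 0"
    and C_cont: "continuous_on {0<..} C"
    and lam_lo: "lam_lo > 0" "\<phi> lam_lo < p"
    and lam_hi: "lam_hi > 0" "\<phi> lam_hi > p"
  shows "(\<exists>k lam. bisection \<phi> p lam_lo lam_hi k = Stopped lam \<and> lam > 0 \<and> \<phi> lam = p) \<or>
         (\<exists>lo hi lam. (\<forall>k. bisection \<phi> p lam_lo lam_hi k = Running (lo k) (hi k)) \<and>
            lo \<longlonglongrightarrow> lam \<and> hi \<longlonglongrightarrow> lam \<and> lam > 0 \<and> \<phi> lam = p)"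
proof -
  interpret control_problem \<theta> u0 C f L a
    by unfold_locales (fact assms)+
  have "closed_segment lam_lo lam_hi \<subseteq> {0<..}"
    using lam_lo lam_hi by (intro closed_segment_subset) auto
  then show ?thesis
    using bisection_converges[of lam_lo lam_hi \<phi> p] lam_lo lam_hi
      continuous_on_subset[OF control_map_cont] unfolding \<phi>_def by fastforce
qed

end
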